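(* Let $(X,\nabla,g)$ be a compact Hessian manifold, written as $X=\Omega/G$ as described in the context, and let $g'$ be a Hessian metric on $(X,\nabla)$ in the same class as $g$. Let $\Phi:\Omega\to\mathbb{R}$ and $\Phi':\Omega\to\mathbb{R}$ be potentials of $g$ and $g'$, respectively. Then $\partial\Phi(\Omega)=\partial\Phi'(\Omega)$, and the action of $G$ induced on $\partial\Phi(\Omega)$ by $\Phi$ is the same as the action induced by $\Phi'$.
   Context: An affine structure on a smooth manifold $X$ of dimension $d\ge 1$ is a flat torsion-free connection $\nabla$ on the tangent bundle of $X$ (equivalently, an atlas whose transition functions are affine; its charts give affine coordinates). A Hessian metric on $(X,\nabla)$ is a Riemannian metric $g$ which locally, in affine coordinates $x_1,\dots,x_d$, is the Hessian of a convex function: $g=\nabla d\phi=\sum_{j,k}\frac{\partial^2\phi}{\partial x_j\partial x_k}dx_j\otimes dx_k$. Then $(X,\nabla,g)$ is called a Hessian manifold. Two Hessian metrics $g,g'$ on $(X,\nabla)$ lie in the same class if $g-g'=\nabla d\phi$ for some smooth function $\phi:X\to\mathbb{R}$. Every compact Hessian manifold $(X,\nabla,g)$ can be written as $X=\Omega/G$, where $\Omega\subset\mathbb{R}^d$ is a non-empty open convex set, $G$ is a subgroup of $\mathrm{GL}_d(\mathbb{R})\rtimes\mathbb{R}^d$ preserving $\Omega$, the quotient map $p:\Omega\to X$ is the universal covering, and $\nabla$ is inherited from the standard connection on $\mathbb{R}^d$. A potential of $g$ on $\Omega$ is a smooth, strictly convex function $\Phi:\Omega\to\mathbb{R}$ whose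 Hessian $\sum_{i,j}\frac{\partial^2\Phi}{\partial x_i\partial x_j}dx_i\otimes dx_j$ is the pullback $p^*g$; similarly for $g'$. For such a $\Phi$, $\partial\Phi:\Omega\to(\mathbb{R}^d)^*$ denotes the gradient map, which is a diffeomorphism onto its image $\partial\Phi(\Omega)$. The action of $G$ on $\partial\Phi(\Omega)$ induced by $\Phi$ is the push-forward of the action on $\Omega$: for $h\in G$ and $m\in\Omega$, $h(\partial\Phi(m))=\partial\Phi(h(m))$; similarly for $\Phi'$.
   Formalization: False for arbitrary potentials, which are only fixed up to affine functions (e.g. −ln x and x−ln x on (0,∞)/2^ℤ). Proved instead: the claim holds if Φ−Φ' descends to X; for any potentials it holds after adding a suitable linear functional to Φ'. *)

theory Defs
  imports "HOL-Analysis.Analysis" "HOL-Algebra.Group"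
begin

section \<open>Calculus on open subsets of Euclidean space\<close>

text \<open>Only used on open sets, where \<^const>\<open>frechet_derivative\<close> at a point depends only on the
  values of the function near that point.\<close>

primrec Ck_on :: "nat \<Rightarrow> ('a::real_normed_vector) set \<Rightarrow> ('a \<Rightarrow> real) \<Rightarrow> bool" where
  "Ck_on 0 S f \<longleftrightarrow> continuous_on S f"
| "Ck_on (Suc k) S f \<longleftrightarrow>
     (\<forall>x\<in>S. f differentiable (at x)) \<and>
     (\<forall>v. Ck_on k S (\<lambda>x. frechet_derivative f (at x) v))"

definition smooth_on :: "('a::real_normed_vector) set \<Rightarrow> ('a \<Rightarrow> real) \<Rightarrow> bool" where
  "smooth_on S f \<longleftrightarrow> (\<forall>k. Ck_on k S f)"

definition partial_deriv :: "'n \<Rightarrow> (real^'n \<Rightarrow> real) \<Rightarrow> real^'n \<Rightarrow> real" where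
  "partial_deriv j f x = frechet_derivative f (at x) (axis j 1)"

definition hessian :: "(real^'n \<Rightarrow> real) \<Rightarrow> real^'n \<Rightarrow> real^'n \<Rightarrow> real^'n \<Rightarrow> real" where
  "hessian f x u v =
     (\<Sum>j\<in>UNIV. \<Sum>k\<in>UNIV. partial_deriv j (partial_deriv k f) x * u $ j * v $ k)"

definition strictly_convex_on :: "('a::real_vector) set \<Rightarrow> ('a \<Rightarrow> real) \<Rightarrow> bool" where
  "strictly_convex_on S f \<longleftrightarrow> convex S \<and>
     (\<forall>x\<in>S. \<forall>y\<in>S. \<forall>t. x \<noteq> y \<and> 0 < t \<and> t < 1 \<longrightarrow>
        f ((1 - t) *\<^sub>R x + t *\<^sub>R y) < (1 - t) * f x + t * f y)"

text \<open>The gradient map takes values in the dual space of \<open>real^'n\<close>.\<close>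

definition gradient_map :: "(real^'n \<Rightarrow> real) \<Rightarrow> real^'n \<Rightarrow> ((real^'n) \<Rightarrow>\<^sub>L real)" where
  "gradient_map f x = Blinfun (frechet_derivative f (at x))"


section \<open>The affine group\<close>

text \<open>The pair \<open>(A, b)\<close> stands for the affine map \<open>x \<mapsto> A x + b\<close>.\<close>

definition affine_group :: "((real^'n^'n) \<times> (real^'n)) monoid" where
  "affine_group =
     \<lparr>carrier = {(A, b). invertible A},
      monoid.mult = (\<lambda>(A, a) (B, b). (A ** B, A *v b + a)),
      one = (mat 1, 0)\<rparr>"

definition aff_act :: "(real^'n^'n) \<times> (real^'n) \<Rightarrow> real^'n \<Rightarrow> real^'n" where
  "aff_act h x = fst h *v x + snd h"

text \<open>The affine map is allowed to vary from one connected component of \<open>S\<close> to another.\<close>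

definition locally_affine_on :: "(real^'n) set \<Rightarrow> (real^'n \<Rightarrow> real^'n) \<Rightarrow> bool" where
  "locally_affine_on S f \<longleftrightarrow>
     (\<forall>x\<in>S. \<exists>V h. open V \<and> x \<in> V \<and> h \<in> carrier affine_group \<and>
        (\<forall>y\<in>S \<inter> V. f y = aff_act h y))"


section \<open>Affine manifolds and Hessian metrics\<close>

text \<open>A chart is a pair of an open subset of the manifold and a coordinate map on it. An affine
  structure is given by an atlas with affine transition functions; the atlas need not be maximal.
  The dimension \<open>CARD('n)\<close> is at least 1.\<close>

type_synonym ('x, 'n) chart = "'x set \<times> ('x \<Rightarrow> real^'n)"

definition chart_on ::
    "('x::{t2_space, second_countable_topology}) set \<Rightarrow> ('x, 'n::finite) chart \<Rightarrow> bool" where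
  "chart_on X = (\<lambda>(U, \<phi>). openin (top_of_set X) U \<and> open (\<phi> ` U) \<and>
     homeomorphism U (\<phi> ` U) \<phi> (inv_into U \<phi>))"

definition transition ::
    "('x, 'n::finite) chart \<Rightarrow> ('x, 'n) chart \<Rightarrow> real^'n \<Rightarrow> real^'n" where
  "transition c c' = snd c' \<circ> inv_into (fst c) (snd c)"

definition affine_manifold ::
    "('x::{t2_space, second_countable_topology}) set \<Rightarrow> ('x, 'n::finite) chart set \<Rightarrow> bool" where
  "affine_manifold X \<A> \<longleftrightarrow>
     (\<forall>c\<in>\<A>. chart_on X c) \<and> (\<Union>c\<in>\<A>. fst c) = X \<and>
     (\<forall>c\<in>\<A>. \<forall>c'\<in>\<A>. locally_affine_on (snd c ` (fst c \<inter> fst c')) (transition c c'))"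

definition smooth_fun_on_manifold ::
    "('x, 'n::finite) chart set \<Rightarrow> ('x \<Rightarrow> real) \<Rightarrow> bool" where
  "smooth_fun_on_manifold \<A> f \<longleftrightarrow>
     (\<forall>(U, \<phi>)\<in>\<A>. smooth_on (\<phi> ` U) (f \<circ> inv_into U \<phi>))"

text \<open>A covariant 2-tensor field is given by its coordinate expressions: \<open>g c x u v\<close> is its value
  at the point \<open>x\<close> on the two tangent vectors whose coordinates in the chart \<open>c\<close> are \<open>u\<close> and \<open>v\<close>.
  The last clause of the next definition is the transformation law under change of charts.\<close>

type_synonym ('x, 'n) tensor2 = "('x, 'n) chart \<Rightarrow> 'x \<Rightarrow> real^'n \<Rightarrow> real^'n \<Rightarrow> real"

definition riemannian_metric ::
    "('x, 'n::finite) chart set \<Rightarrow> ('x, 'n) tensor2 \<Rightarrow> bool" where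
  "riemannian_metric \<A> g \<longleftrightarrow>
     (\<forall>c\<in>\<A>. \<forall>x\<in>fst c.
        bilinear (g c x) \<and> (\<forall>u v. g c x u v = g c x v u) \<and> (\<forall>u. u \<noteq> 0 \<longrightarrow> g c x u u > 0)) \<and>
     (\<forall>c\<in>\<A>. \<forall>u v. smooth_on (snd c ` fst c) (\<lambda>y. g c (inv_into (fst c) (snd c) y) u v)) \<and>
     (\<forall>c\<in>\<A>. \<forall>c'\<in>\<A>. \<forall>x\<in>fst c \<inter> fst c'. \<forall>u v.
        g c x u v =
        g c' x (frechet_derivative (transition c c') (at (snd c x)) u)
               (frechet_derivative (transition c c') (at (snd c x)) v))"

definition hessian_metric ::
    "('x, 'n::finite) chart set \<Rightarrow> ('x, 'n) tensor2 \<Rightarrow> bool" where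
  "hessian_metric \<A> g \<longleftrightarrow> riemannian_metric \<A> g \<and>
     (\<forall>(U, \<phi>)\<in>\<A>. \<forall>x\<in>U. \<exists>V f. open V \<and> \<phi> x \<in> V \<and> V \<subseteq> \<phi> ` U \<and>
        smooth_on V f \<and> convex_on V f \<and>
        (\<forall>y\<in>V. \<forall>u v. g (U, \<phi>) (inv_into U \<phi> y) u v = hessian f y u v))"

definition hessian_manifold ::
    "('x::{t2_space, second_countable_topology}) set \<Rightarrow> ('x, 'n::finite) chart set
       \<Rightarrow> ('x, 'n) tensor2 \<Rightarrow> bool" where
  "hessian_manifold X \<A> g \<longleftrightarrow> affine_manifold X \<A> \<and> hessian_metric \<A> g"

definition same_hessian_class ::
    "('x, 'n::finite) chart set \<Rightarrow> ('x, 'n) tensor2 \<Rightarrow> ('x, 'n) tensor2 \<Rightarrow> bool" where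
  "same_hessian_class \<A> g g' \<longleftrightarrow>
     (\<exists>f. smooth_fun_on_manifold \<A> f \<and>
        (\<forall>(U, \<phi>)\<in>\<A>. \<forall>x\<in>U. \<forall>u v.
           g (U, \<phi>) x u v - g' (U, \<phi>) x u v = hessian (f \<circ> inv_into U \<phi>) (\<phi> x) u v))"


section \<open>Presentation as a quotient of a convex domain\<close>

text \<open>The space \<open>X\<close> is \<open>\<Omega>/G\<close>: the fibres of the covering \<open>p\<close> are the orbits of \<open>G\<close>. As \<open>\<Omega>\<close> is
  convex, hence simply connected, \<open>p\<close> is the universal covering. The last clause says that the
  affine structure of \<open>X\<close> is inherited from the standard one.\<close>

definition affine_quotient ::
    "(real^'n) set \<Rightarrow> ((real^'n^'n) \<times> (real^'n)) set \<Rightarrow> (real^'n \<Rightarrow> 'x)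
       \<Rightarrow> ('x::{t2_space, second_countable_topology}) set \<Rightarrow> ('x, 'n::finite) chart set \<Rightarrow> bool" where
  "affine_quotient \<Omega> G p X \<A> \<longleftrightarrow>
     \<Omega> \<noteq> {} \<and> open \<Omega> \<and> convex \<Omega> \<and>
     subgroup G affine_group \<and> (\<forall>h\<in>G. aff_act h ` \<Omega> = \<Omega>) \<and>
     covering_space \<Omega> p X \<and>
     (\<forall>m\<in>\<Omega>. \<forall>m'\<in>\<Omega>. p m = p m' \<longleftrightarrow> (\<exists>h\<in>G. m' = aff_act h m)) \<and>
     (\<forall>(U, \<phi>)\<in>\<A>. locally_affine_on {m \<in> \<Omega>. p m \<in> U} (\<phi> \<circ> p))"

text \<open>The right-hand side of the last equation is the pullback of \<open>g\<close> along \<open>p\<close>, computed in any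
  chart around \<open>p m\<close>.\<close>

definition potential ::
    "(real^'n) set \<Rightarrow> (real^'n \<Rightarrow> 'x) \<Rightarrow> ('x, 'n::finite) chart set \<Rightarrow> ('x, 'n) tensor2
       \<Rightarrow> (real^'n \<Rightarrow> real) \<Rightarrow> bool" where
  "potential \<Omega> p \<A> g \<Phi> \<longleftrightarrow>
     smooth_on \<Omega> \<Phi> \<and> strictly_convex_on \<Omega> \<Phi> \<and>
     (\<forall>m\<in>\<Omega>. \<forall>(U, \<phi>)\<in>\<A>. p m \<in> U \<longrightarrow>
        (\<forall>u v. hessian \<Phi> m u v =
           g (U, \<phi>) (p m) (frechet_derivative (\<phi> \<circ> p) (at m) u)
                          (frechet_derivative (\<phi> \<circ> p) (at m) v)))"

text \<open>Push-forward along the gradient map of the action of \<open>h\<close>; meant for arguments in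
  \<open>gradient_map \<Phi> ` \<Omega>\<close>, on which the gradient map of a potential has a unique preimage.\<close>

definition induced_action ::
    "(real^'n) set \<Rightarrow> (real^'n \<Rightarrow> real) \<Rightarrow> (real^'n^'n) \<times> (real^'n)
       \<Rightarrow> ((real^'n) \<Rightarrow>\<^sub>L real) \<Rightarrow> ((real^'n) \<Rightarrow>\<^sub>L real)" where
  "induced_action \<Omega> \<Phi> h \<xi> =
     gradient_map \<Phi> (aff_act h (inv_into \<Omega> (gradient_map \<Phi>) \<xi>))"

text \<open>A potential is determined by its metric only up to an affine function. Adding to \<open>\<Phi>\<close> a
  function with constant derivative \<open>l\<close> translates the image of the gradient map by \<open>l\<close> and
  conjugates the induced action by this translation. Potentials \<open>\<Phi>\<close>, \<open>\<Phi>'\<close> of two metrics of the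
  same class can thus only be compared if these affine functions match, that is, if \<open>\<Phi> - \<Phi>'\<close>
  descends to \<open>X\<close>; otherwise \<open>\<Phi>'\<close> first has to be corrected by a linear functional. For instance,
  \<open>- ln x\<close> and \<open>x - ln x\<close> are potentials of the same metric on the quotient of the positive
  half-line by multiplication with powers of 2, with gradient images \<open>{..<0}\<close> and \<open>{..<1}\<close>.\<close>

definition same_image_and_action ::
    "(real^'n) set \<Rightarrow> ((real^'n^'n) \<times> (real^'n)) set
       \<Rightarrow> (real^'n \<Rightarrow> real) \<Rightarrow> (real^'n \<Rightarrow> real) \<Rightarrow> bool" where
  "same_image_and_action \<Omega> G \<Phi> \<Phi>' \<longleftrightarrow>
     gradient_map \<Phi> ` \<Omega> = gradient_map \<Phi>' ` \<Omega> \<and>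
     (\<forall>h\<in>G. \<forall>\<xi>\<in>gradient_map \<Phi> ` \<Omega>.
        induced_action \<Omega> \<Phi> h \<xi> = induced_action \<Omega> \<Phi>' h \<xi>)"

end

theory Submission
  imports Defs
begin

text \<open>For a potential \<open>\<Phi>\<close> and \<open>h \<in> G\<close> the function \<open>\<Phi> \<circ> h - \<Phi>\<close> has zero Hessian, hence is affine,
  so the Bregman divergence of \<open>\<Phi>\<close> is \<open>G\<close>-invariant. As \<open>X\<close> is compact, there is \<open>\<delta> > 0\<close> such
  that from every point and in every direction the divergence reaches \<open>\<delta>\<close> inside \<open>\<Omega>\<close>. If
  \<open>\<Phi> - \<xi>\<close> has a minimum, it therefore exceeds every bound along every ray from the minimum, and its
  sublevel sets are compact. If moreover \<open>\<Phi> - \<Phi>'\<close> descends to \<open>X\<close>, it is bounded, so \<open>\<Phi>' - \<xi>\<close> attains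
  its minimum too, and the gradient images agree. The induced actions agree because both
  are given by the linear part of \<open>\<Phi> \<circ> h - \<Phi> = \<Phi>' \<circ> h - \<Phi>'\<close>. In general \<open>\<Phi> - \<Phi>' - f \<circ> p\<close> has zero
  Hessian, where \<open>f\<close> relates the two metrics, and its linear part is the required correction.\<close>

section \<open>Second derivatives\<close>

definition has_hessian ::
    "('a::real_normed_vector \<Rightarrow> real) \<Rightarrow> ('a \<Rightarrow> 'a \<Rightarrow> real) \<Rightarrow> 'a \<Rightarrow> bool" where
  "has_hessian f H x \<longleftrightarrow> (\<exists>W f'. open W \<and> x \<in> W \<and> (\<forall>y\<in>W. (f has_derivative f' y) (at y)) \<and>
     (\<forall>v. ((\<lambda>y. f' y v) has_derivative (\<lambda>u. H u v)) (at x)))"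

lemma has_hessian_diff:
  assumes "has_hessian f H x" and "has_hessian g K x"
  shows "has_hessian (\<lambda>y. f y - g y) (\<lambda>u v. H u v - K u v) x"
proof -
  obtain V f' where V: "open V" "x \<in> V" "\<And>y. y \<in> V \<Longrightarrow> (f has_derivative f' y) (at y)"
      "\<And>v. ((\<lambda>y. f' y v) has_derivative (\<lambda>u. H u v)) (at x)"
    using assms(1) unfolding has_hessian_def by metis
  obtain W g' where W: "open W" "x \<in> W" "\<And>y. y \<in> W \<Longrightarrow> (g has_derivative g' y) (at y)"
      "\<And>v. ((\<lambda>y. g' y v) has_derivative (\<lambda>u. K u v)) (at x)"
    using assms(2) unfolding has_hessian_def by metis
  show ?thesis
    unfolding has_hessian_def
  proof (intro exI conjI ballI allI)
    show "open (V \<inter> W)" "x \<in> V \<inter> W" using V W by auto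
    show "((\<lambda>y. f y - g y) has_derivative (\<lambda>v. f' y v - g' y v)) (at y)" if "y \<in> V \<inter> W" for y
      using V(3) W(3) that by (auto intro: has_derivative_diff)
    show "((\<lambda>y. f' y v - g' y v) has_derivative (\<lambda>u. H u v - K u v)) (at x)" for v
      by (rule has_derivative_diff[OF V(4) W(4)])
  qed
qed

lemma has_hessian_transform:
  assumes "has_hessian f H x" and "open S" and "x \<in> S" and "\<And>y. y \<in> S \<Longrightarrow> f y = g y"
  shows "has_hessian g H x"
proof -
  obtain V f' where V: "open V" "x \<in> V" "\<And>y. y \<in> V \<Longrightarrow> (f has_derivative f' y) (at y)"
      "\<And>v. ((\<lambda>y. f' y v) has_derivative (\<lambda>u. H u v)) (at x)"
    using assms(1) unfolding has_hessian_def by metis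
  have "(g has_derivative f' y) (at y)" if "y \<in> V \<inter> S" for y
    using has_derivative_transform_within_open[OF V(3) assms(2)] that assms(4) by auto
  with V assms(2,3) show ?thesis
    unfolding has_hessian_def by (intro exI[of _ "V \<inter> S"] exI[of _ f']) auto
qed

lemma has_derivative_aff_act: "(aff_act h has_derivative (\<lambda>u. fst h *v u)) F"
proof -
  have "((\<lambda>x. fst h *v x + snd h) has_derivative (\<lambda>u. fst h *v u)) F"
    by (intro has_derivative_add_const bounded_linear.has_derivative[OF _ has_derivative_ident]
        matrix_vector_mul_bounded_linear)
  then show ?thesis unfolding aff_act_def[abs_def] .
qed

lemma continuous_on_aff_act: "continuous_on S (aff_act h)"
  by (rule has_derivative_continuous_on[OF has_derivative_aff_act])

lemma has_hessian_aff_act: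
  assumes "has_hessian f H (aff_act h x)"
  shows "has_hessian (\<lambda>y. f (aff_act h y)) (\<lambda>u v. H (fst h *v u) (fst h *v v)) x"
proof -
  obtain V f' where V: "open V" "aff_act h x \<in> V" "\<And>y. y \<in> V \<Longrightarrow> (f has_derivative f' y) (at y)"
      "\<And>v. ((\<lambda>y. f' y v) has_derivative (\<lambda>u. H u v)) (at (aff_act h x))"
    using assms unfolding has_hessian_def by metis
  show ?thesis
    unfolding has_hessian_def
  proof (intro exI conjI ballI allI)
    show "open (aff_act h -` V)"
      using V(1) continuous_on_aff_act[of UNIV h] by (simp add: continuous_on_open_vimage)
    show "x \<in> aff_act h -` V" using V(2) by simp
    show "((\<lambda>y. f (aff_act h y)) has_derivative (\<lambda>v. f' (aff_act h y) (fst h *v v))) (at y)"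
      if "y \<in> aff_act h -` V" for y
      using has_derivative_compose[OF has_derivative_aff_act V(3)] that by simp
    show "((\<lambda>y. f' (aff_act h y) (fst h *v v)) has_derivative
        (\<lambda>u. H (fst h *v u) (fst h *v v))) (at x)" for v
      using has_derivative_compose[OF has_derivative_aff_act V(4)] by simp
  qed
qed

lemma affine_if_has_hessian_zero:
  fixes f :: "'a::real_normed_vector \<Rightarrow> real"
  assumes "open S" and "convex S" and H: "\<And>x. x \<in> S \<Longrightarrow> has_hessian f (\<lambda>u v. 0) x"
  obtains l :: "'a \<Rightarrow>\<^sub>L real" and c where "\<And>x. x \<in> S \<Longrightarrow> f x = blinfun_apply l x + c"
proof (cases "S = {}")
  case True
  then show ?thesis using that by auto
next
  case False
  then obtain a where a: "a \<in> S" by auto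
  define D where "D x = frechet_derivative f (at x)" for x
  have D: "(f has_derivative D x) (at x)" if "x \<in> S" for x
    using H[OF that] unfolding has_hessian_def D_def
    by (metis differentiableI frechet_derivative_works)
  have D0: "((\<lambda>y. D y v) has_derivative (\<lambda>u. 0)) (at x within S)" if x: "x \<in> S" for x v
  proof -
    obtain V f' where V: "open V" "x \<in> V" "\<And>y. y \<in> V \<Longrightarrow> (f has_derivative f' y) (at y)"
        "\<And>v. ((\<lambda>y. f' y v) has_derivative (\<lambda>u. 0)) (at x)"
      using H[OF x] unfolding has_hessian_def by metis
    have "f' y v = D y v" if "y \<in> V" for y
      unfolding D_def using frechet_derivative_at[OF V(3)[OF that]] by simp
    then have "((\<lambda>y. D y v) has_derivative (\<lambda>u. 0)) (at x)"
      by (rule has_derivative_transform_within_open[OF V(4) V(1,2)])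
    then show ?thesis by (rule has_derivative_at_withinI)
  qed
  have const: "D x v = D a v" if "x \<in> S" for x v
  proof -
    obtain c where "\<And>y. y \<in> S \<Longrightarrow> D y v = c"
      using has_derivative_zero_constant[OF assms(2) D0] by metis
    then show ?thesis using that a by simp
  qed
  define l where "l = Blinfun (D a)"
  have l: "blinfun_apply l = D a"
    unfolding l_def by (rule bounded_linear_Blinfun_apply[OF has_derivative_bounded_linear[OF D[OF a]]])
  have "((\<lambda>y. f y - blinfun_apply l y) has_derivative (\<lambda>u. 0)) (at x within S)" if "x \<in> S" for x
  proof -
    have "((\<lambda>y. f y - blinfun_apply l y) has_derivative (\<lambda>u. D x u - blinfun_apply l u)) (at x)"
      by (intro has_derivative_diff D that bounded_linear_imp_has_derivative
          blinfun.bounded_linear_right)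
    then show ?thesis
      using const[OF that] by (simp add: l has_derivative_at_withinI)
  qed
  then have "\<exists>c. \<forall>y\<in>S. f y - blinfun_apply l y = c"
    by (rule has_derivative_zero_constant[OF assms(2)])
  then obtain c where "\<And>y. y \<in> S \<Longrightarrow> f y - blinfun_apply l y = c" by blast
  then show ?thesis using that[of l c] by (simp add: algebra_simps)
qed

lemma Ck_on_Suc_has_derivative:
  assumes "Ck_on (Suc k) S f" and "x \<in> S"
  shows "(f has_derivative frechet_derivative f (at x)) (at x)"
  using assms by (simp add: frechet_derivative_works)

lemma has_hessian_hessian:
  fixes f :: "real^'n \<Rightarrow> real"
  assumes "smooth_on S f" and "open S" and x: "x \<in> S"
  shows "has_hessian f (hessian f x) x"
proof -
  define D where "D y = frechet_derivative f (at y)" for y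
  have C2: "Ck_on (Suc (Suc 0)) S f" using assms(1) unfolding smooth_on_def by blast
  have D: "(f has_derivative D y) (at y)" if "y \<in> S" for y
    unfolding D_def by (rule Ck_on_Suc_has_derivative[OF C2 that])
  have dD: "((\<lambda>y. D y v) has_derivative frechet_derivative (\<lambda>y. D y v) (at x)) (at x)" for v
    using C2 x unfolding D_def by (simp add: frechet_derivative_works)
  have pd: "partial_deriv k f = (\<lambda>y. D y (axis k 1))" for k
    by (simp add: fun_eq_iff partial_deriv_def D_def)
  have expand: "L u = (\<Sum>j\<in>UNIV. L (axis j 1) * u $ j)" if "linear L" for L :: "real^'n \<Rightarrow> real" and u
  proof -
    have "L u = L (\<Sum>j\<in>UNIV. u $ j *\<^sub>R axis j 1)"
      using basis_expansion[of u] by (simp add: scalar_mult_eq_scaleR)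
    also have "\<dots> = (\<Sum>j\<in>UNIV. u $ j *\<^sub>R L (axis j 1))"
      using that by (simp add: linear_sum linear_scale)
    finally show ?thesis by (simp add: mult.commute)
  qed
  have "((\<lambda>y. D y v) has_derivative (\<lambda>u. hessian f x u v)) (at x)" for v
  proof -
    have *: "((\<lambda>y. \<Sum>k\<in>UNIV. D y (axis k 1) * v $ k) has_derivative
        (\<lambda>u. \<Sum>k\<in>UNIV. frechet_derivative (\<lambda>y. D y (axis k 1)) (at x) u * v $ k)) (at x)"
      by (intro has_derivative_sum has_derivative_mult_left dD)
    have "(\<Sum>k\<in>UNIV. frechet_derivative (\<lambda>y. D y (axis k 1)) (at x) u * v $ k) = hessian f x u v"
      for u
    proof -
      have "frechet_derivative (\<lambda>y. D y (axis k 1)) (at x) u =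
          (\<Sum>j\<in>UNIV. partial_deriv j (partial_deriv k f) x * u $ j)" for k
        unfolding pd unfolding partial_deriv_def
        by (rule expand[OF has_derivative_linear[OF dD]])
      then show ?thesis
        unfolding hessian_def by (subst sum.swap) (simp add: sum_distrib_right)
    qed
    with * have "((\<lambda>y. \<Sum>k\<in>UNIV. D y (axis k 1) * v $ k) has_derivative
        (\<lambda>u. hessian f x u v)) (at x)" by simp
    then show ?thesis
      by (rule has_derivative_transform_within_open[OF _ assms(2) x])
        (use expand[OF has_derivative_linear[OF D]] in simp)
  qed
  with D assms(2) x show ?thesis
    unfolding has_hessian_def by blast
qed


section \<open>Convex functions under a cocompact affine action\<close>

lemma has_derivative_line:
  fixes f :: "'a::real_normed_vector \<Rightarrow> real"
  assumes "(f has_derivative f') (at x)"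
  shows "((\<lambda>t. f (x + t *\<^sub>R w)) has_real_derivative f' w) (at 0)"
proof -
  interpret bounded_linear f' by (rule has_derivative_bounded_linear[OF assms])
  have "((\<lambda>t::real. x + t *\<^sub>R w) has_derivative (\<lambda>t. t *\<^sub>R w)) (at 0)"
    by (auto intro!: derivative_eq_intros)
  from has_derivative_compose[OF this, of f f'] assms
  have "((\<lambda>t. f (x + t *\<^sub>R w)) has_derivative (\<lambda>t. f' (t *\<^sub>R w))) (at 0)" by simp
  then show ?thesis
    by (simp add: has_field_derivative_def scale mult.commute[of _ "f' w"])
qed

lemma strictly_convex_on_imp_convex_on:
  assumes "strictly_convex_on S f"
  shows "convex_on S f"
proof (rule convex_onI)
  fix t :: real and x y
  assume *: "0 < t" "t < 1" "x \<in> S" "y \<in> S"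
  show "f ((1 - t) *\<^sub>R x + t *\<^sub>R y) \<le> (1 - t) * f x + t * f y"
  proof (cases "x = y")
    case True
    then show ?thesis by (simp add: algebra_simps flip: scaleR_add_left)
  next
    case False
    with assms * show ?thesis unfolding strictly_convex_on_def by (meson less_imp_le)
  qed
qed (use assms in \<open>simp add: strictly_convex_on_def\<close>)

lemma convex_on_above_tangent:
  fixes f :: "'a::real_normed_vector \<Rightarrow> real"
  assumes "convex_on S f" and "x \<in> S" and "y \<in> S" and D: "(f has_derivative f') (at x)"
  shows "f x + f' (y - x) \<le> f y"
proof -
  have "((\<lambda>t. f (x + t *\<^sub>R (y - x))) has_real_derivative f' (y - x)) (at 0)"
    by (rule has_derivative_line[OF D])
  then have "((\<lambda>t. (f (x + t *\<^sub>R (y - x)) - f x) / t) \<longlongrightarrow> f' (y - x)) (at_right 0)"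
    by (simp add: has_field_derivative_iff filterlim_at_split)
  moreover have "eventually (\<lambda>t. (f (x + t *\<^sub>R (y - x)) - f x) / t \<le> f y - f x) (at_right (0::real))"
  proof (rule eventually_mono[OF eventually_at_right_less[of 0, THEN eventually_conj,
        OF eventually_at_right_real[of 0 1]]])
    fix t :: real
    assume "0 < t \<and> t \<in> {0<..<1}"
    then have t: "0 < t" "t < 1" by auto
    have "f ((1 - t) *\<^sub>R x + t *\<^sub>R y) \<le> (1 - t) * f x + t * f y"
      using convex_onD[OF assms(1)] t assms(2,3) by simp
    moreover have "(1 - t) *\<^sub>R x + t *\<^sub>R y = x + t *\<^sub>R (y - x)"
      by (simp add: algebra_simps)
    ultimately show "(f (x + t *\<^sub>R (y - x)) - f x) / t \<le> f y - f x"
      using t by (simp add: field_simps)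
  qed simp
  ultimately have "f' (y - x) \<le> f y - f x"
    by (rule tendsto_upperbound) simp
  then show ?thesis by simp
qed

lemma strictly_convex_on_above_tangent:
  fixes f :: "'a::real_normed_vector \<Rightarrow> real"
  assumes "strictly_convex_on S f" and "x \<in> S" and "y \<in> S" and "x \<noteq> y"
    and D: "(f has_derivative f') (at x)"
  shows "f x + f' (y - x) < f y"
proof -
  let ?z = "(1 - 1/2) *\<^sub>R x + (1/2) *\<^sub>R y"
  have S: "convex S" using assms(1) by (simp add: strictly_convex_on_def)
  have z: "?z \<in> S" by (rule convexD_alt[OF S assms(2,3)]) auto
  have "f ?z < (1 - 1/2) * f x + 1/2 * f y"
    using assms(1)[unfolded strictly_convex_on_def, THEN conjunct2, rule_format, of x y "1/2"] assms(2-4)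
    by simp
  moreover have "f x + f' (?z - x) \<le> f ?z"
    by (rule convex_on_above_tangent[OF strictly_convex_on_imp_convex_on[OF assms(1)] assms(2) z D])
  moreover have "?z - x = (1/2) *\<^sub>R (y - x)"
    by (simp add: algebra_simps flip: scaleR_add_left)
  then have "f' (?z - x) = 1/2 * f' (y - x)"
    using linear_scale[OF has_derivative_linear[OF D]] by simp
  ultimately show ?thesis by simp
qed

lemma blinfun_apply_gradient_map:
  assumes "f differentiable (at x)"
  shows "blinfun_apply (gradient_map f x) = frechet_derivative f (at x)"
  unfolding gradient_map_def using assms
  by (intro bounded_linear_Blinfun_apply has_derivative_bounded_linear)
    (auto simp: frechet_derivative_works)

locale cocompact_affine_action =
  fixes \<Omega> :: "(real^'n::finite) set" and G :: "((real^'n^'n) \<times> (real^'n)) set"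
    and K :: "(real^'n) set"
  assumes open_domain: "open \<Omega>" and convex_domain: "convex \<Omega>"
    and invertible: "h \<in> G \<Longrightarrow> invertible (fst h)"
    and image_domain: "h \<in> G \<Longrightarrow> aff_act h ` \<Omega> = \<Omega>"
    and compact_fundamental: "compact K" and fundamental_subset: "K \<subseteq> \<Omega>"
    and fundamental_cover: "m \<in> \<Omega> \<Longrightarrow> \<exists>h\<in>G. \<exists>k\<in>K. m = aff_act h k"
begin

lemma aff_act_in_domain: "h \<in> G \<Longrightarrow> m \<in> \<Omega> \<Longrightarrow> aff_act h m \<in> \<Omega>"
  using image_domain by blast

definition equivariant_potential :: "(real^'n \<Rightarrow> real) \<Rightarrow> bool" where
  "equivariant_potential f \<longleftrightarrow> Ck_on (Suc 0) \<Omega> f \<and> strictly_convex_on \<Omega> f \<and>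
     (\<forall>h\<in>G. \<exists>(l :: (real^'n) \<Rightarrow>\<^sub>L real) c. \<forall>m\<in>\<Omega>. f (aff_act h m) = f m + blinfun_apply l m + c)"

context
  fixes f :: "real^'n \<Rightarrow> real"
  assumes f: "equivariant_potential f"
begin

lemma deriv: "x \<in> \<Omega> \<Longrightarrow> (f has_derivative frechet_derivative f (at x)) (at x)"
  using f Ck_on_Suc_has_derivative unfolding equivariant_potential_def by blast

lemma convex_on_potential: "convex_on \<Omega> f"
  using f strictly_convex_on_imp_convex_on unfolding equivariant_potential_def by blast

lemma continuous_on_potential: "continuous_on \<Omega> f"
  by (rule has_derivative_continuous_on) (rule has_derivative_at_withinI[OF deriv])

lemma deriv_aff_act:
  assumes h: "h \<in> G" and x: "x \<in> \<Omega>"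
    and l: "\<And>m. m \<in> \<Omega> \<Longrightarrow> f (aff_act h m) = f m + blinfun_apply l m + c"
  shows "frechet_derivative f (at (aff_act h x)) (fst h *v v) =
    frechet_derivative f (at x) v + blinfun_apply l v"
proof -
  have "((\<lambda>m. f (aff_act h m)) has_derivative
      (\<lambda>v. frechet_derivative f (at (aff_act h x)) (fst h *v v))) (at x)"
    by (rule has_derivative_compose[OF has_derivative_aff_act deriv[OF aff_act_in_domain[OF h x]]])
  moreover have "((\<lambda>m. f m + blinfun_apply l m + c) has_derivative
      (\<lambda>v. frechet_derivative f (at x) v + blinfun_apply l v)) (at x)"
    by (intro has_derivative_add_const has_derivative_add deriv x
        bounded_linear_imp_has_derivative blinfun.bounded_linear_right)
  then have "((\<lambda>m. f (aff_act h m)) has_derivative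
      (\<lambda>v. frechet_derivative f (at x) v + blinfun_apply l v)) (at x)"
    by (rule has_derivative_transform_within_open[OF _ open_domain x]) (simp add: l)
  ultimately show ?thesis by (rule has_derivative_unique[THEN fun_cong])
qed

lemma uniform_bregman_gap:
  obtains \<delta> where "\<delta> > 0" and
    "\<And>m w. m \<in> \<Omega> \<Longrightarrow> w \<noteq> 0 \<Longrightarrow> \<exists>r>0. m + r *\<^sub>R w \<in> \<Omega> \<and>
       f m + r * frechet_derivative f (at m) w + \<delta> \<le> f (m + r *\<^sub>R w)"
proof -
  obtain e where e: "e > 0" "(\<Union>k\<in>K. cball k e) \<subseteq> \<Omega>"
    by (rule compact_subset_open_imp_cball_epsilon_subset[OF compact_fundamental open_domain
          fundamental_subset])
  have shift: "k + w \<in> \<Omega>" if "k \<in> K" "norm w = e" for k w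
    using e(2) that by (fastforce simp: dist_norm)
  define D where "D z = f (fst z + snd z) - f (fst z) -
    (\<Sum>j\<in>UNIV. snd z $ j * frechet_derivative f (at (fst z)) (axis j 1))" for z :: "(real^'n) \<times> (real^'n)"
  let ?C = "K \<times> sphere (0::real^'n) e"
  have D_eq: "D (k, w) = f (k + w) - f k - frechet_derivative f (at k) w" if "k \<in> \<Omega>" for k w
  proof -
    have lin: "linear (frechet_derivative f (at k))"
      using deriv[OF that] has_derivative_linear by blast
    have "frechet_derivative f (at k) w = frechet_derivative f (at k) (\<Sum>j\<in>UNIV. w $ j *\<^sub>R axis j 1)"
      using basis_expansion[of w] by (simp add: scalar_mult_eq_scaleR)
    also have "\<dots> = (\<Sum>j\<in>UNIV. w $ j * frechet_derivative f (at k) (axis j 1))"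
      using lin by (simp add: linear_sum linear_scale)
    finally show ?thesis by (simp add: D_def)
  qed
  have cont_pd: "continuous_on \<Omega> (\<lambda>x. frechet_derivative f (at x) v)" for v
    using f by (simp add: equivariant_potential_def)
  have "continuous_on ?C D"
    unfolding D_def using fundamental_subset shift
    by (intro continuous_intros continuous_on_compose2[OF continuous_on_potential]
        continuous_on_compose2[OF cont_pd]) auto
  moreover have "compact ?C" by (intro compact_Times compact_fundamental) simp
  moreover have "0 < D z" if "z \<in> ?C" for z
  proof -
    obtain k w where z: "z = (k, w)" "k \<in> K" "norm w = e" using \<open>z \<in> ?C\<close> by auto
    have k: "k \<in> \<Omega>" using z fundamental_subset by auto
    have "k \<noteq> k + w" using z e(1) by auto
    from strictly_convex_on_above_tangent[OF _ k shift[OF z(2,3)] this deriv[OF k]] f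
    show ?thesis by (simp add: z(1) D_eq[OF k] equivariant_potential_def)
  qed
  ultimately obtain \<delta> where \<delta>: "\<delta> > 0" "\<And>z. z \<in> ?C \<Longrightarrow> \<delta> \<le> D z"
  proof (cases "?C = {}")
    case True
    then show ?thesis using that[of 1] by auto
  next
    case False
    assume *: "continuous_on ?C D" "compact ?C" "\<And>z. z \<in> ?C \<Longrightarrow> 0 < D z"
    then obtain z where "z \<in> ?C" "\<And>y. y \<in> ?C \<Longrightarrow> D z \<le> D y"
      using continuous_attains_inf[OF *(2) False *(1)] by blast
    then show ?thesis using that[of "D z"] * by blast
  qed
  show ?thesis
  proof (rule that[OF \<delta>(1)])
    fix m w :: "real^'n"
    assume m: "m \<in> \<Omega>" and w: "w \<noteq> 0"
    obtain h k where h: "h \<in> G" "k \<in> K" "m = aff_act h k" using fundamental_cover[OF m] by blast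
    have k: "k \<in> \<Omega>" using h fundamental_subset by auto
    obtain B where B: "fst h ** B = mat 1"
      using invertible[OF h(1)] by (auto simp: invertible_def)
    define w' where "w' = B *v w"
    have Aw': "fst h *v w' = w"
      by (simp add: w'_def matrix_vector_mul_assoc B)
    then have "w' \<noteq> 0" using w by auto
    define r where "r = e / norm w'"
    have r: "r > 0" using e(1) \<open>w' \<noteq> 0\<close> by (simp add: r_def)
    have nr: "norm (r *\<^sub>R w') = e" using e(1) \<open>w' \<noteq> 0\<close> by (simp add: r_def)
    have hx: "aff_act h (k + r *\<^sub>R w') = m + r *\<^sub>R w"
      by (simp add: h(3) aff_act_def matrix_vector_right_distrib matrix_vector_mult_scaleR Aw')
    obtain l :: "(real^'n) \<Rightarrow>\<^sub>L real" and c where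
      l: "\<And>m. m \<in> \<Omega> \<Longrightarrow> f (aff_act h m) = f m + blinfun_apply l m + c"
      using f h(1) unfolding equivariant_potential_def by blast
    have x: "k + r *\<^sub>R w' \<in> \<Omega>" by (rule shift[OF h(2) nr])
    have "\<delta> \<le> D (k, r *\<^sub>R w')" by (rule \<delta>(2)) (use h(2) nr in auto)
    also have "\<dots> = f (k + r *\<^sub>R w') - f k - r * frechet_derivative f (at k) w'"
      using linear_scale[OF has_derivative_linear[OF deriv[OF k]]] by (simp add: D_eq[OF k])
    also have "\<dots> = f (m + r *\<^sub>R w) - f m - r * frechet_derivative f (at m) w"
      using l[OF x] l[OF k] deriv_aff_act[OF h(1) k l, of w']
      by (simp add: hx Aw' flip: h(3)) (simp add: blinfun.add_right blinfun.scaleR_right algebra_simps)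
    finally show "\<exists>r>0. m + r *\<^sub>R w \<in> \<Omega> \<and>
        f m + r * frechet_derivative f (at m) w + \<delta> \<le> f (m + r *\<^sub>R w)"
      using r aff_act_in_domain[OF h(1) x] by (auto simp: hx intro!: exI[of _ r])
  qed
qed

lemma unbounded_on_rays:
  assumes m: "m \<in> \<Omega>" and w: "w \<noteq> 0" and \<xi>: "\<xi> = gradient_map f m"
  obtains t where "t > 0" and "m + t *\<^sub>R w \<in> \<Omega>"
    and "c < f (m + t *\<^sub>R w) - blinfun_apply \<xi> (m + t *\<^sub>R w)"
proof -
  define u where "u x = f x - blinfun_apply \<xi> x" for x
  have \<xi>': "blinfun_apply \<xi> = frechet_derivative f (at m)"
    unfolding \<xi> by (rule blinfun_apply_gradient_map) (rule differentiableI[OF deriv[OF m]])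
  obtain \<delta> where \<delta>: "\<delta> > 0" "\<And>m w. m \<in> \<Omega> \<Longrightarrow> w \<noteq> 0 \<Longrightarrow> \<exists>r>0. m + r *\<^sub>R w \<in> \<Omega> \<and>
       f m + r * frechet_derivative f (at m) w + \<delta> \<le> f (m + r *\<^sub>R w)"
    by (rule uniform_bregman_gap) blast
  have mono: "\<exists>r>0. m + (t + r) *\<^sub>R w \<in> \<Omega> \<and> u (m + t *\<^sub>R w) + \<delta> \<le> u (m + (t + r) *\<^sub>R w)"
    if t: "t \<ge> 0" "m + t *\<^sub>R w \<in> \<Omega>" for t
  proof -
    let ?x = "m + t *\<^sub>R w"
    have "f m + frechet_derivative f (at m) (?x - m) \<le> f ?x"
      by (rule convex_on_above_tangent[OF convex_on_potential m t(2) deriv[OF m]])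
    moreover have "f ?x + frechet_derivative f (at ?x) (m - ?x) \<le> f m"
      by (rule convex_on_above_tangent[OF convex_on_potential t(2) m deriv[OF t(2)]])
    moreover have "frechet_derivative f (at ?x) (m - ?x) = - t * frechet_derivative f (at ?x) w"
      using linear_scale[OF has_derivative_linear[OF deriv[OF t(2)]], of "-t" w] by simp
    moreover have "frechet_derivative f (at m) (?x - m) = t * blinfun_apply \<xi> w"
      using linear_scale[OF has_derivative_linear[OF deriv[OF m]], of t w] by (simp add: \<xi>')
    ultimately have "t * blinfun_apply \<xi> w \<le> t * frechet_derivative f (at ?x) w" by simp
    then have le: "blinfun_apply \<xi> w \<le> frechet_derivative f (at ?x) w"
      using t(1) by (cases "t = 0") (auto simp: \<xi>')
    obtain r where r: "r > 0" "?x + r *\<^sub>R w \<in> \<Omega>"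
        "f ?x + r * frechet_derivative f (at ?x) w + \<delta> \<le> f (?x + r *\<^sub>R w)"
      using \<delta>(2)[OF t(2) w] by blast
    have "r * blinfun_apply \<xi> w \<le> r * frechet_derivative f (at ?x) w"
      using le r(1) by simp
    with r(3) have "u ?x + \<delta> \<le> u (?x + r *\<^sub>R w)"
      by (simp add: u_def blinfun.add_right blinfun.scaleR_right)
    moreover have "m + (t + r) *\<^sub>R w = ?x + r *\<^sub>R w" by (simp add: algebra_simps)
    ultimately show ?thesis using r(1,2) by metis
  qed
  let ?T = "{t. t \<ge> 0 \<and> m + t *\<^sub>R w \<in> \<Omega>}"
  define M where "M = (SUP t\<in>?T. u (m + t *\<^sub>R w))"
  show ?thesis
  proof (rule ccontr)
    assume "\<not> thesis"
    then have le: "u (m + t *\<^sub>R w) \<le> c" if "t > 0" "m + t *\<^sub>R w \<in> \<Omega>" for t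
      using that \<open>\<And>t. _ \<Longrightarrow> _ \<Longrightarrow> _ \<Longrightarrow> thesis\<close> unfolding u_def by (meson not_le)
    have "u (m + t *\<^sub>R w) \<le> max c (u m)" if "t \<in> ?T" for t
      using le[of t] that by (cases "t = 0") (auto simp: le_max_iff_disj)
    then have bdd: "bdd_above ((\<lambda>t. u (m + t *\<^sub>R w)) ` ?T)" by (auto simp: bdd_above_def)
    have ne: "?T \<noteq> {}" using m by (auto intro: exI[of _ 0])
    have "M - \<delta> < M" using \<delta>(1) by simp
    then obtain t where t: "t \<in> ?T" "M - \<delta> < u (m + t *\<^sub>R w)"
      unfolding M_def using less_cSUP_iff[OF ne bdd] by blast
    then obtain r where r: "r > 0" "m + (t + r) *\<^sub>R w \<in> \<Omega>"
        "u (m + t *\<^sub>R w) + \<delta> \<le> u (m + (t + r) *\<^sub>R w)"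
      using mono[of t] by blast
    have "u (m + (t + r) *\<^sub>R w) \<le> M"
      unfolding M_def by (rule cSUP_upper[OF _ bdd]) (use t r in auto)
    then show False using t r by simp
  qed
qed

lemma compact_sublevel:
  assumes m: "m \<in> \<Omega>" and \<xi>: "\<xi> = gradient_map f m"
  shows "compact {x \<in> \<Omega>. f x - blinfun_apply \<xi> x \<le> c}" (is "compact ?S")
proof -
  define u where "u x = f x - blinfun_apply \<xi> x" for x
  have cont: "continuous_on \<Omega> u"
    unfolding u_def by (intro continuous_intros continuous_on_potential)
  have conv: "convex_on \<Omega> u"
  proof -
    have "convex_on \<Omega> (\<lambda>x. - blinfun_apply \<xi> x)"
      by (rule convex_onI) (auto simp: convex_domain blinfun.add_right blinfun.scaleR_right)
    from convex_on_add[OF convex_on_potential this] show ?thesis by (simp add: u_def[abs_def])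
  qed
  have \<xi>': "blinfun_apply \<xi> = frechet_derivative f (at m)"
    unfolding \<xi> by (rule blinfun_apply_gradient_map) (rule differentiableI[OF deriv[OF m]])
  have min: "u m \<le> u x" if "x \<in> \<Omega>" for x
    using convex_on_above_tangent[OF convex_on_potential m that deriv[OF m]]
    by (simp add: u_def blinfun.diff_right flip: \<xi>')
  show ?thesis
    unfolding compact_def
  proof (intro allI impI)
    fix x :: "nat \<Rightarrow> real^'n"
    assume "\<forall>n. x n \<in> ?S"
    then have x: "x n \<in> \<Omega>" "u (x n) \<le> c" for n by (auto simp: u_def)
    define s where "s n = norm (x n - m)" for n
    define w where "w n = (if x n = m then axis undefined 1 else sgn (x n - m))" for n
    have xs: "x n = m + s n *\<^sub>R w n" for n
      by (auto simp: s_def w_def sgn_div_norm)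
    have "w n \<in> sphere 0 1" for n by (simp add: w_def norm_sgn)
    then obtain v q where q: "v \<in> sphere 0 1" "strict_mono q" "(w \<circ> q) \<longlonglongrightarrow> v"
      using compact_sphere[of "0::real^'n" 1] unfolding compact_def by blast
    have "v \<noteq> 0" using q(1) by auto
    then obtain t where t: "t > 0" "m + t *\<^sub>R v \<in> \<Omega>" "c < u (m + t *\<^sub>R v)"
      using unbounded_on_rays[OF m _ \<xi>] unfolding u_def by blast
    have lim: "(\<lambda>n. m + t *\<^sub>R w (q n)) \<longlonglongrightarrow> m + t *\<^sub>R v"
      using q(3) by (intro tendsto_intros) (simp add: o_def)
    have ev\<Omega>: "eventually (\<lambda>n. m + t *\<^sub>R w (q n) \<in> \<Omega>) sequentially"
      using lim open_domain t(2) by (rule topological_tendstoD)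
    have "(\<lambda>n. u (m + t *\<^sub>R w (q n))) \<longlonglongrightarrow> u (m + t *\<^sub>R v)"
      by (rule continuous_on_tendsto_compose[OF cont lim t(2) ev\<Omega>])
    then have "eventually (\<lambda>n. c < u (m + t *\<^sub>R w (q n))) sequentially"
      using t(3) by (rule order_tendstoD)
    with ev\<Omega> have ev: "eventually (\<lambda>n. min (s (q n)) t = s (q n)) sequentially"
    proof eventually_elim
      case (elim n)
      show ?case
      proof (rule ccontr)
        assume "min (s (q n)) t \<noteq> s (q n)"
        then have st: "t < s (q n)" by auto
        define a where "a = t / s (q n)"
        have a: "0 \<le> a" "a \<le> 1" using st t(1) by (auto simp: a_def)
        have "m + t *\<^sub>R w (q n) = (1 - a) *\<^sub>R m + a *\<^sub>R x (q n)"
          unfolding xs using st t(1) by (simp add: a_def algebra_simps)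
        then have "u (m + t *\<^sub>R w (q n)) \<le> (1 - a) * u m + a * u (x (q n))"
          using convex_onD[OF conv a m x(1)] by simp
        also have "\<dots> \<le> (1 - a) * c + a * c"
          using a min[OF x(1)] x(2) by (intro add_mono mult_left_mono) (auto intro: order_trans)
        finally show False using elim by (simp add: algebra_simps)
      qed
    qed
    have "min (s (q n)) t \<in> {0..t}" for n using t(1) by (simp add: s_def)
    then obtain b q' where q': "b \<in> {0..t}" "strict_mono q'" "((\<lambda>n. min (s (q n)) t) \<circ> q') \<longlonglongrightarrow> b"
      using compact_Icc[of 0 t] unfolding compact_def by metis
    have "eventually (\<lambda>n. min (s (q (q' n))) t = s (q (q' n))) sequentially"
      using ev by (rule eventually_compose_filterlim[OF _ filterlim_subseq[OF q'(2)]])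
    then have s_lim: "(\<lambda>n. s (q (q' n))) \<longlonglongrightarrow> b"
      using q'(3) unfolding o_def by (rule Lim_transform_eventually[rotated])
    have "(\<lambda>n. w (q (q' n))) \<longlonglongrightarrow> v"
      using LIMSEQ_subseq_LIMSEQ[OF q(3) q'(2)] by (simp add: o_def)
    with s_lim have x_lim: "(\<lambda>n. x (q (q' n))) \<longlonglongrightarrow> m + b *\<^sub>R v"
      unfolding xs by (intro tendsto_intros)
    have "m + b *\<^sub>R v = (1 - b / t) *\<^sub>R m + (b / t) *\<^sub>R (m + t *\<^sub>R v)"
      using t(1) by (simp add: algebra_simps)
    moreover have "\<dots> \<in> \<Omega>"
      by (rule convexD_alt[OF convex_domain m t(2)]) (use q'(1) t(1) in auto)
    ultimately have in\<Omega>: "m + b *\<^sub>R v \<in> \<Omega>" by simp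
    have "(\<lambda>n. u (x (q (q' n)))) \<longlonglongrightarrow> u (m + b *\<^sub>R v)"
      by (rule continuous_on_tendsto_compose[OF cont x_lim in\<Omega>]) (simp add: x)
    then have "u (m + b *\<^sub>R v) \<le> c"
      by (rule LIMSEQ_le_const2) (simp add: x)
    with in\<Omega> x_lim show "\<exists>l\<in>?S. \<exists>r. strict_mono r \<and> (x \<circ> r) \<longlonglongrightarrow> l"
      using strict_mono_o[OF q(2) q'(2)]
      by (intro bexI[of _ "m + b *\<^sub>R v"] exI[of _ "q \<circ> q'"]) (auto simp: u_def o_def)
  qed
qed

end

lemma gradient_image_subset:
  assumes f: "equivariant_potential f" and f2: "equivariant_potential f2"
    and B: "\<And>m. m \<in> \<Omega> \<Longrightarrow> \<bar>f m - f2 m\<bar> \<le> B"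
  shows "gradient_map f ` \<Omega> \<subseteq> gradient_map f2 ` \<Omega>"
proof
  fix \<xi>
  assume "\<xi> \<in> gradient_map f ` \<Omega>"
  then obtain m where m: "m \<in> \<Omega>" "\<xi> = gradient_map f m" by blast
  define u where "u x = f x - blinfun_apply \<xi> x" for x
  define u2 where "u2 x = f2 x - blinfun_apply \<xi> x" for x
  let ?S = "{x \<in> \<Omega>. f x - blinfun_apply \<xi> x \<le> u m + 2 * B}"
  have "0 \<le> B" using B[OF m(1)] by linarith
  then have mS: "m \<in> ?S" using m(1) by (simp add: u_def)
  have "continuous_on ?S u2"
    unfolding u2_def
    by (intro continuous_intros continuous_on_subset[OF continuous_on_potential[OF f2]]) auto
  from continuous_attains_inf[OF compact_sublevel[OF f m] _ this] mS
  obtain z where z: "z \<in> ?S" "\<And>y. y \<in> ?S \<Longrightarrow> u2 z \<le> u2 y" by blast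
  have zmin: "u2 z \<le> u2 y" if y: "y \<in> \<Omega>" for y
  proof (cases "y \<in> ?S")
    case False
    then have "u m + 2 * B < u y" using y by (simp add: u_def)
    moreover have "u y - B \<le> u2 y" "u2 m \<le> u m + B"
      using B[OF y] B[OF m(1)] by (auto simp: u_def u2_def)
    ultimately show ?thesis using z(2)[OF mS] by linarith
  qed (rule z(2))
  have z\<Omega>: "z \<in> \<Omega>" using z by simp
  have "(u2 has_derivative (\<lambda>v. frechet_derivative f2 (at z) v - blinfun_apply \<xi> v)) (at z)"
    unfolding u2_def by (intro has_derivative_diff deriv[OF f2 z\<Omega>]
        bounded_linear_imp_has_derivative blinfun.bounded_linear_right)
  from differential_zero_maxmin[OF z\<Omega> open_domain this] zmin
  have "frechet_derivative f2 (at z) v = blinfun_apply \<xi> v" for v by (auto simp: fun_eq_iff)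
  then have "gradient_map f2 z = \<xi>"
    by (intro blinfun_eqI) (simp add: blinfun_apply_gradient_map[OF differentiableI[OF deriv[OF f2 z\<Omega>]]])
  then show "\<xi> \<in> gradient_map f2 ` \<Omega>" using z\<Omega> by blast
qed

lemma same_image_and_action:
  assumes f: "equivariant_potential f" and f2: "equivariant_potential f2"
    and inv: "\<And>h m. h \<in> G \<Longrightarrow> m \<in> \<Omega> \<Longrightarrow>
      f (aff_act h m) - f2 (aff_act h m) = f m - f2 m"
  shows "same_image_and_action \<Omega> G f f2"
proof -
  have "continuous_on K (\<lambda>x. f x - f2 x)"
    by (intro continuous_intros continuous_on_subset[OF continuous_on_potential fundamental_subset] f f2)
  then have "bounded ((\<lambda>x. f x - f2 x) ` K)"
    by (intro compact_imp_bounded compact_continuous_image compact_fundamental)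
  then obtain B where B: "\<And>k. k \<in> K \<Longrightarrow> \<bar>f k - f2 k\<bar> \<le> B"
    by (auto simp: bounded_iff)
  have bound: "\<bar>f m - f2 m\<bar> \<le> B" if "m \<in> \<Omega>" for m
    using fundamental_cover[OF that] B inv fundamental_subset by (metis subsetD)
  have image: "gradient_map f ` \<Omega> = gradient_map f2 ` \<Omega>"
    using gradient_image_subset[OF f f2] gradient_image_subset[OF f2 f] bound
    by (metis abs_minus_commute subset_antisym)
  have "induced_action \<Omega> f h \<xi> = induced_action \<Omega> f2 h \<xi>"
    if h: "h \<in> G" and \<xi>: "\<xi> \<in> gradient_map f ` \<Omega>" for h \<xi>
  proof -
    define m where "m = inv_into \<Omega> (gradient_map f) \<xi>"
    define m2 where "m2 = inv_into \<Omega> (gradient_map f2) \<xi>"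
    have m: "m \<in> \<Omega>" "gradient_map f m = \<xi>"
      using \<xi> by (auto simp: m_def inv_into_into f_inv_into_f)
    have m2: "m2 \<in> \<Omega>" "gradient_map f2 m2 = \<xi>"
      using \<xi> image by (auto simp: m2_def inv_into_into f_inv_into_f)
    have gm: "blinfun_apply (gradient_map g x) = frechet_derivative g (at x)"
      if "equivariant_potential g" "x \<in> \<Omega>" for g x
      using that by (intro blinfun_apply_gradient_map differentiableI[OF deriv])
    obtain l :: "(real^'n) \<Rightarrow>\<^sub>L real" and c where
      l: "\<And>x. x \<in> \<Omega> \<Longrightarrow> f (aff_act h x) = f x + blinfun_apply l x + c"
      using f h unfolding equivariant_potential_def by blast
    have l2: "f2 (aff_act h x) = f2 x + blinfun_apply l x + c" if "x \<in> \<Omega>" for x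
      using l[OF that] inv[OF h that] by simp
    obtain A where A: "fst h ** A = mat 1"
      using invertible[OF h] by (auto simp: invertible_def)
    have "frechet_derivative f (at (aff_act h m)) v = frechet_derivative f2 (at (aff_act h m2)) v"
      for v
    proof -
      have v: "v = fst h *v (A *v v)" by (simp add: matrix_vector_mul_assoc A)
      have "frechet_derivative f (at m) = frechet_derivative f2 (at m2)"
        using m m2 gm f f2 by metis
      then show ?thesis
        by (subst (1 2) v) (simp add: deriv_aff_act[OF f h m(1) l] deriv_aff_act[OF f2 h m2(1) l2])
    qed
    then show ?thesis
      unfolding induced_action_def m_def[symmetric] m2_def[symmetric]
      by (intro blinfun_eqI) (simp add: gm f f2 aff_act_in_domain h m m2)
  qed
  with image show ?thesis by (simp add: same_image_and_action_def)
qed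

lemma equivariant_potential_add_linear:
  assumes f: "equivariant_potential f"
  shows "equivariant_potential (\<lambda>x. f x + blinfun_apply k x)"
proof -
  let ?f = "\<lambda>x. f x + blinfun_apply k x"
  have d: "(?f has_derivative (\<lambda>v. frechet_derivative f (at x) v + blinfun_apply k v)) (at x)"
    if "x \<in> \<Omega>" for x
    by (intro has_derivative_add deriv[OF f that] bounded_linear_imp_has_derivative
        blinfun.bounded_linear_right)
  have fd: "frechet_derivative ?f (at x) v = frechet_derivative f (at x) v + blinfun_apply k v"
    if "x \<in> \<Omega>" for x v
    using frechet_derivative_at[OF d[OF that]] by (metis (no_types))
  have cont: "continuous_on \<Omega> (\<lambda>x. frechet_derivative f (at x) v)" for v
    using f by (simp add: equivariant_potential_def)
  have "continuous_on \<Omega> (\<lambda>x. frechet_derivative f (at x) v + blinfun_apply k v)" for v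
    by (intro continuous_intros cont)
  then have "continuous_on \<Omega> (\<lambda>x. frechet_derivative ?f (at x) v)" for v
    by (rule continuous_on_eq) (simp add: fd)
  then have "Ck_on (Suc 0) \<Omega> ?f"
    using d by (auto intro: differentiableI)
  moreover have "strictly_convex_on \<Omega> ?f"
    unfolding strictly_convex_on_def
  proof (intro conjI ballI allI impI)
    fix x y and t :: real
    assume *: "x \<in> \<Omega>" "y \<in> \<Omega>" "x \<noteq> y \<and> 0 < t \<and> t < 1"
    then have "f ((1 - t) *\<^sub>R x + t *\<^sub>R y) < (1 - t) * f x + t * f y"
      using f by (simp add: equivariant_potential_def strictly_convex_on_def)
    then show "?f ((1 - t) *\<^sub>R x + t *\<^sub>R y) < (1 - t) * ?f x + t * ?f y"
      by (simp add: blinfun.add_right blinfun.scaleR_right distrib_left)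
  qed (rule convex_domain)
  moreover have "\<exists>(l' :: (real^'n) \<Rightarrow>\<^sub>L real) c'. \<forall>m\<in>\<Omega>. ?f (aff_act h m) = ?f m + blinfun_apply l' m + c'"
    if h: "h \<in> G" for h
  proof -
    obtain l :: "(real^'n) \<Rightarrow>\<^sub>L real" and c where
      l: "\<And>m. m \<in> \<Omega> \<Longrightarrow> f (aff_act h m) = f m + blinfun_apply l m + c"
      using f h unfolding equivariant_potential_def by blast
    define kh where "kh = Blinfun (\<lambda>v. blinfun_apply k (fst h *v v))"
    have kh: "blinfun_apply kh v = blinfun_apply k (fst h *v v)" for v
      unfolding kh_def by (subst bounded_linear_Blinfun_apply)
        (auto intro: bounded_linear_compose[OF blinfun.bounded_linear_right matrix_vector_mul_bounded_linear])
    have "?f (aff_act h m) = ?f m + blinfun_apply (l + kh - k) m + (c + blinfun_apply k (snd h))"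
      if "m \<in> \<Omega>" for m
      using l[OF that] by (simp add: plus_blinfun.rep_eq minus_blinfun.rep_eq kh)
        (simp add: aff_act_def blinfun.add_right)
    then show ?thesis by blast
  qed
  ultimately show ?thesis by (simp add: equivariant_potential_def)
qed

end


section \<open>Potentials on the universal covering\<close>

text \<open>The library version \<open>covering_space_open_map\<close> is restricted to metric spaces.\<close>

lemma covering_space_imp_open_map:
  fixes S :: "'a::topological_space set" and B :: "'b::topological_space set"
  assumes cov: "covering_space S p B" and T: "openin (top_of_set S) T"
  shows "openin (top_of_set B) (p ` T)"
proof (subst openin_subopen, intro ballI)
  fix y
  assume "y \<in> p ` T"
  then obtain x where x: "x \<in> T" "y = p x" by blast
  then have "x \<in> S" using openin_imp_subset[OF T] by blast
  then obtain V U q where V: "x \<in> V" "openin (top_of_set S) V" "openin (top_of_set B) U"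
      "homeomorphism V U p q"
    by (rule covering_space_local_homeomorphism[OF cov])
  have "openin (top_of_set V) (T \<inter> V)"
    using openin_Int[OF T V(2)] openin_imp_subset[OF V(2)] by (meson inf_le2 openin_subset_trans)
  then have "openin (top_of_set U) (p ` (T \<inter> V))"
    by (rule homeomorphism_imp_open_map[OF V(4)])
  then have "openin (top_of_set B) (p ` (T \<inter> V))" using V(3) by (rule openin_trans)
  then show "\<exists>W. openin (top_of_set B) W \<and> y \<in> W \<and> W \<subseteq> p ` T"
    using x V(1) by blast
qed

lemma affine_quotient_cocompact:
  assumes q: "affine_quotient \<Omega> G p X \<A>" and "compact X"
  obtains K where "cocompact_affine_action \<Omega> G K"
proof -
  have \<Omega>: "open \<Omega>" "convex \<Omega>" and sub: "subgroup G affine_group"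
    and im: "\<And>h. h \<in> G \<Longrightarrow> aff_act h ` \<Omega> = \<Omega>" and cov: "covering_space \<Omega> p X"
    and orb: "\<And>m m'. m \<in> \<Omega> \<Longrightarrow> m' \<in> \<Omega> \<Longrightarrow> p m = p m' \<longleftrightarrow> (\<exists>h\<in>G. m' = aff_act h m)"
    using q unfolding affine_quotient_def by auto
  have "\<forall>m\<in>\<Omega>. \<exists>e>0. cball m e \<subseteq> \<Omega>" using \<Omega>(1) open_contains_cball by blast
  then obtain e where e: "\<And>m. m \<in> \<Omega> \<Longrightarrow> e m > 0 \<and> cball m (e m) \<subseteq> \<Omega>" by metis
  have opn: "openin (top_of_set X) (p ` ball m (e m))" if "m \<in> \<Omega>" for m
  proof (rule covering_space_imp_open_map[OF cov])
    have "ball m (e m) \<subseteq> \<Omega>" using e[OF that] by (meson ball_subset_cball subset_trans)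
    then show "openin (top_of_set \<Omega>) (ball m (e m))" by (simp add: open_subset)
  qed
  have X: "X = p ` \<Omega>" using covering_space_imp_surjective[OF cov] by simp
  have "X \<subseteq> (\<Union>m\<in>\<Omega>. p ` ball m (e m))"
    unfolding X using e by (fastforce intro!: imageI)
  then obtain \<D> where \<D>: "\<D> \<subseteq> (\<lambda>m. p ` ball m (e m)) ` \<Omega>" "finite \<D>" "X \<subseteq> \<Union>\<D>"
    using \<open>compact X\<close>[unfolded compact_eq_openin_cover, rule_format,
        of "(\<lambda>m. p ` ball m (e m)) ` \<Omega>"] opn by auto
  obtain D where D: "D \<subseteq> \<Omega>" "finite D" "\<D> = (\<lambda>m. p ` ball m (e m)) ` D"
    using finite_subset_image[OF \<D>(2,1)] by blast
  define K where "K = (\<Union>m\<in>D. cball m (e m))"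
  have "cocompact_affine_action \<Omega> G K"
  proof
    show "open \<Omega>" "convex \<Omega>" by (fact \<Omega>)+
    show "invertible (fst h)" if "h \<in> G" for h
      using subgroup.subset[OF sub] that by (auto simp: affine_group_def)
    show "aff_act h ` \<Omega> = \<Omega>" if "h \<in> G" for h by (rule im[OF that])
    show "compact K" unfolding K_def using D(2) by (intro compact_UN) auto
    show K: "K \<subseteq> \<Omega>" unfolding K_def using D(1) e by blast
    show "\<exists>h\<in>G. \<exists>k\<in>K. m = aff_act h k" if m: "m \<in> \<Omega>" for m
    proof -
      have "p m \<in> X" using X m by blast
      then have "p m \<in> (\<Union>d\<in>D. p ` ball d (e d))" using \<D>(3) unfolding D(3) by (rule rev_subsetD)
      then obtain d k where k: "d \<in> D" "k \<in> ball d (e d)" "p m = p k"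
        by (elim UN_E imageE)
      then have "k \<in> K" unfolding K_def using ball_subset_cball by blast
      moreover from this have "\<exists>h\<in>G. m = aff_act h k"
        using orb[of k m] k(3) K m by (simp add: subset_iff)
      ultimately show ?thesis by blast
    qed
  qed
  then show ?thesis using that by blast
qed

lemma local_coordinates:
  assumes q: "affine_quotient \<Omega> G p X \<A>" and man: "affine_manifold X \<A>"
    and c: "(U, \<phi>) \<in> \<A>" and m: "m \<in> \<Omega>" "p m \<in> U"
  obtains W h where "open W" and "m \<in> W" and "W \<subseteq> \<Omega>" and "p ` W \<subseteq> U"
    and "\<And>y. y \<in> W \<Longrightarrow> \<phi> (p y) = aff_act h y"
    and "((\<phi> \<circ> p) has_derivative (\<lambda>u. fst h *v u)) (at m)"
proof -
  have \<Omega>: "open \<Omega>" and cov: "covering_space \<Omega> p X"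
    and loc: "locally_affine_on {m \<in> \<Omega>. p m \<in> U} (\<phi> \<circ> p)"
    using q c unfolding affine_quotient_def by auto
  have "openin (top_of_set X) U" using man c by (auto simp: affine_manifold_def chart_on_def)
  then have "openin (top_of_set \<Omega>) (\<Omega> \<inter> p -` U)"
    using covering_space_imp_continuous[OF cov] covering_space_imp_surjective[OF cov]
    by (metis continuous_on_open)
  then have op: "open (\<Omega> \<inter> p -` U)" using \<Omega> openin_open_eq by blast
  obtain V h where V: "open V" "m \<in> V"
      "\<And>y. y \<in> {m \<in> \<Omega>. p m \<in> U} \<inter> V \<Longrightarrow> (\<phi> \<circ> p) y = aff_act h y"
    using loc m unfolding locally_affine_on_def by (metis (mono_tags, lifting) mem_Collect_eq)
  let ?W = "\<Omega> \<inter> p -` U \<inter> V"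
  have W: "open ?W" "m \<in> ?W" using op V m by auto
  have eq: "aff_act h y = (\<phi> \<circ> p) y" if "y \<in> ?W" for y using V(3)[of y] that by auto
  have "((\<phi> \<circ> p) has_derivative (\<lambda>u. fst h *v u)) (at m)"
    by (rule has_derivative_transform_within_open[OF has_derivative_aff_act W eq])
  moreover have "\<phi> (p y) = aff_act h y" if "y \<in> ?W" for y using eq[OF that] by simp
  ultimately show ?thesis using that[OF W] by blast
qed

lemma hessian_potential_aff_act:
  assumes q: "affine_quotient \<Omega> G p X \<A>" and man: "affine_manifold X \<A>"
    and pot: "potential \<Omega> p \<A> g \<Phi>" and h: "h \<in> G" and m: "m \<in> \<Omega>"
  shows "hessian \<Phi> (aff_act h m) (fst h *v u) (fst h *v v) = hessian \<Phi> m u v"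
proof -
  have \<Omega>: "open \<Omega>" and im: "aff_act h ` \<Omega> = \<Omega>" and cov: "covering_space \<Omega> p X"
    and orb: "\<And>m m'. m \<in> \<Omega> \<Longrightarrow> m' \<in> \<Omega> \<Longrightarrow> p m = p m' \<longleftrightarrow> (\<exists>h\<in>G. m' = aff_act h m)"
    using q h unfolding affine_quotient_def by auto
  have hm: "aff_act h y \<in> \<Omega>" "p (aff_act h y) = p y" if "y \<in> \<Omega>" for y
  proof -
    show hy: "aff_act h y \<in> \<Omega>" using im that by blast
    show "p (aff_act h y) = p y" using orb[OF that hy] h by auto
  qed
  have "p m \<in> X" using covering_space_imp_surjective[OF cov] m by blast
  then obtain U \<phi> where c: "(U, \<phi>) \<in> \<A>" "p m \<in> U"
    using man unfolding affine_manifold_def by fastforce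
  have "p (aff_act h m) \<in> U" using c(2) hm(2)[OF m] by simp
  then obtain W k where "open W" "aff_act h m \<in> W" "W \<subseteq> \<Omega>" "p ` W \<subseteq> U"
      "\<And>y. y \<in> W \<Longrightarrow> \<phi> (p y) = aff_act k y"
      and k: "((\<phi> \<circ> p) has_derivative (\<lambda>u. fst k *v u)) (at (aff_act h m))"
    by (rule local_coordinates[OF q man c(1) hm(1)[OF m]]) blast
  have "((\<lambda>y. (\<phi> \<circ> p) (aff_act h y)) has_derivative (\<lambda>u. fst k *v (fst h *v u))) (at m)"
    by (rule has_derivative_compose[OF has_derivative_aff_act k])
  then have "((\<phi> \<circ> p) has_derivative (\<lambda>u. fst k *v (fst h *v u))) (at m)"
    by (rule has_derivative_transform_within_open[OF _ \<Omega> m]) (simp add: hm)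
  note fd = frechet_derivative_at[OF this, symmetric] frechet_derivative_at[OF k, symmetric]
  have P: "hessian \<Phi> y u v = g (U, \<phi>) (p y) (frechet_derivative (\<phi> \<circ> p) (at y) u)
      (frechet_derivative (\<phi> \<circ> p) (at y) v)" if "y \<in> \<Omega>" "p y \<in> U" for y u v
    using pot c(1) that unfolding potential_def by fast
  show ?thesis
    using P[OF m c(2)] P[OF hm(1)[OF m]] c(2) by (simp add: hm(2)[OF m] fd)
qed

lemma potential_equivariant:
  fixes \<Omega> :: "(real^'n::finite) set"
  assumes q: "affine_quotient \<Omega> G p X \<A>" and man: "affine_manifold X \<A>"
    and pot: "potential \<Omega> p \<A> g \<Phi>" and act: "cocompact_affine_action \<Omega> G K"
  shows "cocompact_affine_action.equivariant_potential \<Omega> G \<Phi>"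
proof -
  interpret cocompact_affine_action \<Omega> G K by (rule act)
  have smooth: "smooth_on \<Omega> \<Phi>" using pot by (simp add: potential_def)
  have "\<exists>(l :: (real^'n) \<Rightarrow>\<^sub>L real) c. \<forall>m\<in>\<Omega>. \<Phi> (aff_act h m) = \<Phi> m + blinfun_apply l m + c"
    if h: "h \<in> G" for h
  proof -
    have "has_hessian (\<lambda>y. \<Phi> (aff_act h y) - \<Phi> y) (\<lambda>u v. 0) m" if m: "m \<in> \<Omega>" for m
      using has_hessian_diff[OF has_hessian_aff_act[OF has_hessian_hessian[OF smooth open_domain
              aff_act_in_domain[OF h m]]] has_hessian_hessian[OF smooth open_domain m]]
      by (simp add: hessian_potential_aff_act[OF q man pot h m])
    from affine_if_has_hessian_zero[OF open_domain convex_domain this]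
    obtain l :: "(real^'n) \<Rightarrow>\<^sub>L real" and c where
      "\<And>m. m \<in> \<Omega> \<Longrightarrow> \<Phi> (aff_act h m) - \<Phi> m = blinfun_apply l m + c" by blast
    then have "\<forall>m\<in>\<Omega>. \<Phi> (aff_act h m) = \<Phi> m + blinfun_apply l m + c"
      by (metis add.assoc add.commute diff_add_cancel)
    then show ?thesis by blast
  qed
  moreover have "Ck_on (Suc 0) \<Omega> \<Phi>" using smooth unfolding smooth_on_def by blast
  ultimately show ?thesis
    using pot by (simp add: equivariant_potential_def potential_def)
qed

lemma difference_of_potentials:
  fixes \<Omega> :: "(real^'n::finite) set"
  assumes q: "affine_quotient \<Omega> G p X \<A>" and man: "affine_manifold X \<A>"
    and cls: "same_hessian_class \<A> g g'"
    and pot: "potential \<Omega> p \<A> g \<Phi>" and pot': "potential \<Omega> p \<A> g' \<Phi>'"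
  obtains f and l :: "(real^'n) \<Rightarrow>\<^sub>L real"
    where "\<And>m. m \<in> \<Omega> \<Longrightarrow> \<Phi> m - (\<Phi>' m + blinfun_apply l m) = f (p m)"
proof -
  have \<Omega>: "open \<Omega>" "convex \<Omega>" and cov: "covering_space \<Omega> p X"
    using q unfolding affine_quotient_def by auto
  have smooth: "smooth_on \<Omega> \<Phi>" "smooth_on \<Omega> \<Phi>'" using pot pot' by (auto simp: potential_def)
  obtain f where f0: "smooth_fun_on_manifold \<A> f"
      "\<forall>(U, \<phi>)\<in>\<A>. \<forall>x\<in>U. \<forall>u v.
        g (U, \<phi>) x u v - g' (U, \<phi>) x u v = hessian (f \<circ> inv_into U \<phi>) (\<phi> x) u v"
    using cls unfolding same_hessian_class_def by (elim exE conjE)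
  have f: "\<And>U \<phi>. (U, \<phi>) \<in> \<A> \<Longrightarrow> smooth_on (\<phi> ` U) (f \<circ> inv_into U \<phi>)"
      "\<And>U \<phi> x u v. (U, \<phi>) \<in> \<A> \<Longrightarrow> x \<in> U \<Longrightarrow>
        g (U, \<phi>) x u v - g' (U, \<phi>) x u v = hessian (f \<circ> inv_into U \<phi>) (\<phi> x) u v"
    using f0 unfolding smooth_fun_on_manifold_def by fast+
  have "has_hessian (\<lambda>y. (\<Phi> y - \<Phi>' y) - f (p y)) (\<lambda>u v. 0) m" if m: "m \<in> \<Omega>" for m
  proof -
    have "p m \<in> X" using covering_space_imp_surjective[OF cov] m by blast
    then obtain U \<phi> where c: "(U, \<phi>) \<in> \<A>" "p m \<in> U"
      using man unfolding affine_manifold_def by fastforce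
    have "open (\<phi> ` U) \<and> homeomorphism U (\<phi> ` U) \<phi> (inv_into U \<phi>)"
      using man c(1) unfolding affine_manifold_def chart_on_def by blast
    then have ch: "open (\<phi> ` U)" "inj_on \<phi> U"
      by (auto simp: homeomorphism_def intro: inj_on_inverseI)
    obtain W h where W: "open W" "m \<in> W" "W \<subseteq> \<Omega>" "p ` W \<subseteq> U"
        "\<And>y. y \<in> W \<Longrightarrow> \<phi> (p y) = aff_act h y"
        "((\<phi> \<circ> p) has_derivative (\<lambda>u. fst h *v u)) (at m)"
      by (rule local_coordinates[OF q man c(1) m c(2)]) blast
    let ?F = "f \<circ> inv_into U \<phi>"
    note fd = frechet_derivative_at[OF W(6), symmetric]
    have "has_hessian ?F (hessian ?F (aff_act h m)) (aff_act h m)"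
      using W(2,5) c(2) by (intro has_hessian_hessian[OF f(1)[OF c(1)] ch(1)]) force
    from has_hessian_aff_act[OF this]
    have "has_hessian (\<lambda>y. f (p y))
        (\<lambda>u v. hessian ?F (aff_act h m) (fst h *v u) (fst h *v v)) m"
    proof (rule has_hessian_transform[OF _ W(1,2)])
      fix y assume y: "y \<in> W"
      then have "p y \<in> U" using W(4) by blast
      with W(5)[OF y] ch(2) show "?F (aff_act h y) = f (p y)" by (metis comp_apply inv_into_f_f)
    qed
    moreover have "hessian ?F (aff_act h m) (fst h *v u) (fst h *v v) =
        hessian \<Phi> m u v - hessian \<Phi>' m u v" for u v
    proof -
      have "hessian \<Phi> m u v = g (U, \<phi>) (p m) (fst h *v u) (fst h *v v)"
        using pot m c unfolding potential_def by (fastforce simp: fd)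
      moreover have "hessian \<Phi>' m u v = g' (U, \<phi>) (p m) (fst h *v u) (fst h *v v)"
        using pot' m c unfolding potential_def by (fastforce simp: fd)
      ultimately show ?thesis using f(2)[OF c] W(5)[OF W(2)] by simp
    qed
    ultimately show ?thesis
      using has_hessian_diff[OF has_hessian_diff[OF has_hessian_hessian[OF smooth(1) \<Omega>(1) m]
          has_hessian_hessian[OF smooth(2) \<Omega>(1) m]]] by fastforce
  qed
  from affine_if_has_hessian_zero[OF \<Omega> this]
  obtain l :: "(real^'n) \<Rightarrow>\<^sub>L real" and c where
    "\<And>m. m \<in> \<Omega> \<Longrightarrow> (\<Phi> m - \<Phi>' m) - f (p m) = blinfun_apply l m + c" by blast
  then have "\<Phi> m - (\<Phi>' m + blinfun_apply l m) = (\<lambda>x. f x + c) (p m)" if "m \<in> \<Omega>" for m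
    using that by (fastforce simp: algebra_simps)
  then show ?thesis by (rule that)
qed

theorem theorem4p3:
  fixes X :: "('x::{t2_space, second_countable_topology}) set"
    and \<A> :: "('x, 'n::finite) chart set"
    and g g' :: "('x, 'n) tensor2"
    and \<Omega> :: "(real^'n) set"
    and G :: "((real^'n^'n) \<times> (real^'n)) set"
    and p :: "real^'n \<Rightarrow> 'x"
    and \<Phi> \<Phi>' :: "real^'n \<Rightarrow> real"
  assumes "compact X" and "hessian_manifold X \<A> g"
    and "affine_quotient \<Omega> G p X \<A>"
    and "hessian_metric \<A> g'" and "same_hessian_class \<A> g g'"
    and "potential \<Omega> p \<A> g \<Phi>" and "potential \<Omega> p \<A> g' \<Phi>'"
  shows "((\<exists>f. \<forall>m\<in>\<Omega>. \<Phi> m - \<Phi>' m = f (p m)) \<longrightarrow> same_image_and_action \<Omega> G \<Phi> \<Phi>') \<and>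
         (\<exists>l :: (real^'n) \<Rightarrow>\<^sub>L real. same_image_and_action \<Omega> G \<Phi> (\<lambda>x. \<Phi>' x + blinfun_apply l x))"
proof -
  have man: "affine_manifold X \<A>" using assms(2) by (simp add: hessian_manifold_def)
  note q = assms(3)
  obtain K where K: "cocompact_affine_action \<Omega> G K"
    using affine_quotient_cocompact[OF q assms(1)] by blast
  interpret cocompact_affine_action \<Omega> G K by (rule K)
  note pot = potential_equivariant[OF q man assms(6) K] potential_equivariant[OF q man assms(7) K]
  have descends: "same_image_and_action \<Omega> G \<Phi> \<Psi>"
    if "equivariant_potential \<Psi>" and f: "\<And>m. m \<in> \<Omega> \<Longrightarrow> \<Phi> m - \<Psi> m = f (p m)" for \<Psi> f
  proof (rule same_image_and_action[OF pot(1) that(1)])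
    fix h m
    assume h: "h \<in> G" and m: "m \<in> \<Omega>"
    have "p m = p (aff_act h m)"
      using q h m aff_act_in_domain[OF h m] unfolding affine_quotient_def by blast
    then show "\<Phi> (aff_act h m) - \<Psi> (aff_act h m) = \<Phi> m - \<Psi> m"
      by (simp add: f m aff_act_in_domain[OF h m])
  qed
  obtain f and l :: "(real^'n) \<Rightarrow>\<^sub>L real"
    where "\<And>m. m \<in> \<Omega> \<Longrightarrow> \<Phi> m - (\<Phi>' m + blinfun_apply l m) = f (p m)"
    using difference_of_potentials[OF q man assms(5-7)] by blast
  from descends[OF equivariant_potential_add_linear[OF pot(2)] this] descends[OF pot(2)]
  show ?thesis by blast
qed

end
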